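(* Let $p\in\mathbb{R}$, $a>0$, $b>0$, let $g_{p,a,b}$ be the density of the generalized inverse Gaussian distribution with parameters $p,a,b$, let $W$ be a random variable with density $g_{p,a,b}$, let $s(x)=x^2$, and let $h$ be a bounded real-valued function on $(0,\infty)$. Then the equation $$x^2f'(x)+\left(\frac{b}{2}+(p+1)x-\frac{a}{2}x^2\right)f(x)=h(x)-\mathbb{E}\,h(W),\qquad x>0,$$ has solution $$f_h(x)=\frac{1}{s(x)g_{p,a,b}(x)}\int_0^x g_{p,a,b}(t)\left[h(t)-\mathbb{E}\,h(W)\right]dt=\frac{-1}{s(x)g_{p,a,b}(x)}\int_x^{+\infty} g_{p,a,b}(t)\left[h(t)-\mathbb{E}\,h(W)\right]dt,\qquad x>0.$$ Moreover, if $h$ is a bounded continuous function and $p\le -1$, then $f_h$ is the unique bounded solution of this equation, and $$\|f_h\|\le M\,\|h(\cdot)-\mathbb{E}\,h(W)\|,$$ where $$\alpha=\frac{p+1+\sqrt{(p+1)^2+ab}}{a},\qquad M=\max\left(\frac{1}{s(\alpha)g_{p,a,b}(\alpha)}\int_0^\alpha g_{p,a,b}(t)\,dt\,;\ \frac{1}{s(\alpha)g_{p,a,b}(\alpha)}\int_\alpha^{+\infty} g_{p,a,b}(t)\,dt\right).$$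
   Context: The generalized inverse Gaussian (GIG) distribution with parameters $p\in\mathbb{R}$, $a>0$, $b>0$ has density on $(0,\infty)$ $$g_{p,a,b}(x)=\frac{(a/b)^{p/2}}{2K_p(\sqrt{ab})}\,x^{p-1}e^{-\frac12(ax+b/x)},\qquad x>0,$$ where $K_p$ is the modified Bessel function of the third kind (so the prefactor is the normalizing constant). For a function $u$ on $(0,\infty)$, $\|u\|=\sup_{x>0}|u(x)|$.
   Formalization: For merely bounded (Borel measurable) h, "solution" means that f_h is locally Lipschitz and satisfies the equation at almost every x>0 and at every continuity point of h; the equation at every x>0 fails, e.g. for h the indicator of (0,1], where f_h is not differentiable at 1. *)

theory Defs
  imports "HOL-Probability.Probability"
begin

(* Integral representation of the modified Bessel function of the third kind,
   K_p(z) = int_0^oo exp(-z cosh t) cosh(p t) dt; meaningful for z > 0 only. *)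
definition bessel_K :: "real \<Rightarrow> real \<Rightarrow> real" where
  "bessel_K p z = (LBINT t:{0..}. exp (- z * cosh t) * cosh (p * t))"

definition gig_density :: "real \<Rightarrow> real \<Rightarrow> real \<Rightarrow> real \<Rightarrow> real" where
  "gig_density p a b x =
     (if x > 0
      then (a / b) powr (p / 2) / (2 * bessel_K p (sqrt (a * b)))
             * x powr (p - 1) * exp (- (1 / 2) * (a * x + b / x))
      else 0)"

(* Functions on (0,oo) are modelled as functions real => real whose values outside (0,oo)
   are irrelevant.  A random variable with a density supported on (0,oo) is only almost
   surely positive, hence the restriction of the expectation of h(W) to the event W > 0. *)
definition expectation_pos :: "'a measure \<Rightarrow> ('a \<Rightarrow> real) \<Rightarrow> (real \<Rightarrow> real) \<Rightarrow> real" where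
  "expectation_pos \<Omega> W h = (LINT \<omega>:{\<omega> \<in> space \<Omega>. W \<omega> > 0}|\<Omega>. h (W \<omega>))"

(* A genuine supremum only if u is bounded on (0,oo). *)
definition sup_norm_pos :: "(real \<Rightarrow> real) \<Rightarrow> real" where
  "sup_norm_pos u = (SUP x\<in>{0<..}. \<bar>u x\<bar>)"

definition stein_s :: "real \<Rightarrow> real" where
  "stein_s x = x\<^sup>2"

definition gig_stein_eq_at ::
    "real \<Rightarrow> real \<Rightarrow> real \<Rightarrow> (real \<Rightarrow> real) \<Rightarrow> (real \<Rightarrow> real) \<Rightarrow> real \<Rightarrow> bool" where
  "gig_stein_eq_at p a b r f x \<longleftrightarrow>
     (\<exists>f'. (f has_real_derivative f') (at x) \<and>
           x\<^sup>2 * f' + (b / 2 + (p + 1) * x - a / 2 * x\<^sup>2) * f x = r x)"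

definition gig_stein_solution ::
    "real \<Rightarrow> real \<Rightarrow> real \<Rightarrow> (real \<Rightarrow> real) \<Rightarrow> (real \<Rightarrow> real) \<Rightarrow> bool" where
  "gig_stein_solution p a b r f \<longleftrightarrow> (\<forall>x>0. gig_stein_eq_at p a b r f x)"

(* For a discontinuous right-hand side r no function differentiable at every x > 0 need solve
   the equation; a solution is then understood in the Caratheodory sense (locally absolutely
   continuous, equation almost everywhere).  Local Lipschitz continuity implies local absolute
   continuity, and is what a bounded r gives.  At the points where r is continuous
   the equation is required to hold in the classical sense, so that for continuous r
   this is a classical solution. *)
definition gig_stein_solution_ae ::
    "real \<Rightarrow> real \<Rightarrow> real \<Rightarrow> (real \<Rightarrow> real) \<Rightarrow> (real \<Rightarrow> real) \<Rightarrow> bool" where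
  "gig_stein_solution_ae p a b r f \<longleftrightarrow>
     (\<forall>c d. 0 < c \<longrightarrow> (\<exists>L. L-lipschitz_on {c..d} f)) \<and>
     (AE x in lborel. x > 0 \<longrightarrow> gig_stein_eq_at p a b r f x) \<and>
     (\<forall>x>0. isCont r x \<longrightarrow> gig_stein_eq_at p a b r f x)"

(* The function f_h, where r stands for h - E h(W). *)
definition gig_stein_f :: "real \<Rightarrow> real \<Rightarrow> real \<Rightarrow> (real \<Rightarrow> real) \<Rightarrow> real \<Rightarrow> real" where
  "gig_stein_f p a b r x =
     1 / (stein_s x * gig_density p a b x) * (LBINT t:{0<..x}. gig_density p a b t * r t)"

definition gig_alpha :: "real \<Rightarrow> real \<Rightarrow> real \<Rightarrow> real" where
  "gig_alpha p a b = (p + 1 + sqrt ((p + 1)\<^sup>2 + a * b)) / a"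

definition gig_M :: "real \<Rightarrow> real \<Rightarrow> real \<Rightarrow> real" where
  "gig_M p a b =
     (let \<alpha> = gig_alpha p a b in
      max (1 / (stein_s \<alpha> * gig_density p a b \<alpha>) * (LBINT t:{0<..\<alpha>}. gig_density p a b t))
          (1 / (stein_s \<alpha> * gig_density p a b \<alpha>) * (LBINT t:{\<alpha><..}. gig_density p a b t)))"

end

theory Submission
  imports Defs
begin

text \<open>
  Write \<open>g\<close> for the density, \<open>k(x) = x\<^sup>2 g(x)\<close> (\<open>gig_weight\<close>) and
  \<open>\<tau>(x) = b/2 + (p + 1) x - a/2 x\<^sup>2\<close> (\<open>gig_drift\<close>).
  Everything rests on the identity \<open>k' = \<tau> g\<close> (lemma \<open>gig_weight_has_derivative\<close>): it makes \<open>k\<close> an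
  integrating factor, so that on \<open>(0,\<infinity>)\<close> the equation \<open>x\<^sup>2 f' + \<tau> f = r\<close> reads \<open>(k f)' = g r\<close>.
  Hence \<open>f = G / k\<close> is a solution for any primitive \<open>G\<close> of \<open>g r\<close>, and \<open>f\<^sub>h\<close> is the choice of \<open>G\<close>
  that vanishes at \<open>0\<close>. This \<open>G\<close> vanishes at \<open>\<infinity>\<close> as well because \<open>r = h - E h(W)\<close> has mean zero
  under \<open>g\<close>, which is the second formula for \<open>f\<^sub>h\<close>. When \<open>r\<close> is only bounded and measurable,
  \<open>G' = g r\<close> holds at the points of continuity of \<open>r\<close> and, by Lebesgue's differentiation theorem
  (\<open>primitive_has_derivative_AE\<close>), at almost every point.

  Let \<open>P(x)\<close> and \<open>Q(x)\<close> be the masses of \<open>g\<close> on \<open>(0,x]\<close> and on \<open>(x,\<infinity>)\<close> (\<open>lower\<close> and \<open>upper\<close>). The two formulas for \<open>f\<^sub>h\<close>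
  give \<open>\<bar>f\<^sub>h\<bar> \<le> \<parallel>r\<parallel> P / k\<close> and \<open>\<bar>f\<^sub>h\<bar> \<le> \<parallel>r\<parallel> Q / k\<close>. If \<open>p \<le> -1\<close>, then \<open>\<tau>\<close> is decreasing, and
  comparing \<open>\<tau>\<close> with its value at \<open>x\<close> in \<open>k' = \<tau> g\<close> yields the Mills-type inequalities
  \<open>\<tau>(x) P(x) \<le> k(x)\<close> and \<open>-\<tau>(x) Q(x) \<le> k(x)\<close>. They say that \<open>P / k\<close> is increasing and \<open>Q / k\<close> is
  decreasing, so cutting \<open>(0,\<infinity>)\<close> at \<open>\<alpha>\<close> and using the first estimate to the left of \<open>\<alpha>\<close> and the
  second to the right gives the bound by \<open>M\<close> (\<open>stein_f_bound\<close>).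

  The difference \<open>d\<close> of two bounded solutions satisfies \<open>(k d)' = 0\<close>. The constant \<open>k d\<close> is zero since
  \<open>k\<close> tends to \<open>0\<close> at \<open>\<infinity>\<close> (\<open>bounded_stein_solution_unique\<close>).

  Positivity of the normalising factor is a consequence of the existence of \<open>W\<close>: it makes \<open>g\<close> a
  nonnegative function of mass one, so the factor cannot vanish (\<open>density_pos\<close>).
\<close>

section \<open>Primitives of integrable functions\<close>

lemma set_integrable_lborel:
  fixes u :: "real \<Rightarrow> real"
  assumes "integrable lborel u" "A \<in> sets borel"
  shows "set_integrable lborel A u"
  unfolding set_integrable_def using assms by (intro integrable_mult_indicator) auto

lemma primitive_diff_eq_integral:
  fixes u :: "real \<Rightarrow> real"
  assumes u: "integrable lborel u" and "l \<le> x" "x \<le> y"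
  shows "(LBINT t:{l<..y}. u t) - (LBINT t:{l<..x}. u t) = integral {x..y} u"
proof -
  note si = set_integrable_lborel[OF u]
  have "{l<..y} = {l<..x} \<union> {x<..y}" using assms by auto
  then have "(LBINT t:{l<..y}. u t) = (LBINT t:{l<..x}. u t) + (LBINT t:{x<..y}. u t)"
    using set_integral_Un[of "{l<..x}" "{x<..y}" lborel u] si[of "{l<..x}"] si[of "{x<..y}"]
    by (simp add: disjoint_iff)
  moreover have "(LBINT t:{x<..y}. u t) = integral {x<..y} u"
    by (rule set_borel_integral_eq_integral(2)) (rule si, simp)
  moreover have "integral {x<..y} u = integral {x..y} u"
    by (rule integral_spike_set; rule negligible_subset[of "{x}"]) auto
  ultimately show ?thesis by simp
qed

lemma integrable_on_interval:
  fixes u :: "real \<Rightarrow> real"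
  assumes "integrable lborel u"
  shows "u integrable_on {x..y}"
  by (rule set_borel_integral_eq_integral(1)[OF set_integrable_lborel[OF assms]]) simp

text \<open>
  Lebesgue's differentiation theorem for averages over cubes with a fixed lower corner, read off in
  dimension one; a cube is then an interval to the right of its base point.
\<close>

lemma real_lebesgue_right_quotient:
  fixes u :: "real \<Rightarrow> real"
  assumes "\<And>a b. u integrable_on {a..b}"
  obtains N where "negligible N"
    "\<And>x e. x \<notin> N \<Longrightarrow> 0 < e \<Longrightarrow>
       \<exists>d>0. \<forall>h. 0 < h \<and> h < d \<longrightarrow> \<bar>integral {x..x + h} u / h - u x\<bar> < e"
proof -
  have "u integrable_on cbox a b" for a b :: real using assms by simp
  from integrable_ccontinuous_explicit[OF this] obtain N where N: "negligible N"
    "\<And>x e. x \<notin> N \<Longrightarrow> 0 < e \<Longrightarrow> \<exists>d>0. \<forall>h. 0 < h \<and> h < d \<longrightarrow>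
       norm (integral (cbox x (x + h *\<^sub>R One)) u /\<^sub>R h ^ DIM(real) - u x) < e" by blast
  show thesis
  proof (rule that[OF N(1)])
    fix x e :: real assume "x \<notin> N" "0 < e"
    from N(2)[OF this] show "\<exists>d>0. \<forall>h. 0 < h \<and> h < d \<longrightarrow> \<bar>integral {x..x + h} u / h - u x\<bar> < e"
      by (simp add: divide_inverse mult.commute)
  qed
qed

text \<open>
  The right difference quotients converge almost everywhere by the preceding lemma; applied to the
  reflected function \<open>t \<mapsto> u(-t)\<close>, the same lemma takes care of the left ones. A single null set
  serves all base points \<open>l\<close>, because two primitives differ by a constant.
\<close>

theorem primitive_has_derivative_AE:
  fixes u :: "real \<Rightarrow> real"
  assumes u: "integrable lborel u"
  shows "AE x in lborel. \<forall>l<x. ((\<lambda>y. LBINT t:{l<..y}. u t) has_real_derivative u x) (at x)"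
proof -
  have iu: "u integrable_on {x..y}" for x y by (rule integrable_on_interval[OF u])
  have iv: "(\<lambda>t. u (- t)) integrable_on {x..y}" for x y
    using iu[of "- y" "- x"] Henstock_Kurzweil_Integration.integrable_reflect_real[where f = u and a = "- y" and b = "- x"] by simp
  obtain N1 where N1: "negligible N1"
    "\<And>x e. x \<notin> N1 \<Longrightarrow> 0 < e \<Longrightarrow>
       \<exists>d>0. \<forall>h. 0 < h \<and> h < d \<longrightarrow> \<bar>integral {x..x + h} u / h - u x\<bar> < e"
    using real_lebesgue_right_quotient[OF iu] by blast
  obtain N2 where N2: "negligible N2"
    "\<And>x e. x \<notin> N2 \<Longrightarrow> 0 < e \<Longrightarrow>
       \<exists>d>0. \<forall>h. 0 < h \<and> h < d \<longrightarrow> \<bar>integral {x..x + h} (\<lambda>t. u (- t)) / h - u (- x)\<bar> < e"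
    using real_lebesgue_right_quotient[OF iv] by blast
  have "negligible (N1 \<union> uminus ` N2)"
    using N1(1) N2(1) by (intro negligible_Un negligible_differentiable_image_negligible)
      (auto simp: differentiable_on_def intro!: derivative_intros)
  then have "AE x in lebesgue. x \<notin> N1 \<union> uminus ` N2"
    by (intro AE_not_in) (simp add: negligible_iff_null_sets)
  then have "AE x in lborel. x \<notin> N1 \<union> uminus ` N2"
    by (simp add: AE_completion_iff)
  then show ?thesis
  proof (rule AE_mp, intro AE_I2 impI allI)
    fix x l :: real assume xN: "x \<notin> N1 \<union> uminus ` N2" and "l < x"
    let ?G = "\<lambda>y. LBINT t:{l<..y}. u t"
    have x1: "x \<notin> N1" and x2: "- x \<notin> N2"
      using xN by (auto simp: image_iff)
    show "(?G has_real_derivative u x) (at x)"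
      unfolding DERIV_def LIM_def
    proof (intro allI impI)
      fix e :: real assume e: "0 < e"
      obtain d1 where d1: "d1 > 0"
        "\<And>h. 0 < h \<Longrightarrow> h < d1 \<Longrightarrow> \<bar>integral {x..x + h} u / h - u x\<bar> < e"
        using N1(2)[OF x1 e] by blast
      obtain d2 where d2: "d2 > 0"
        "\<And>h. 0 < h \<Longrightarrow> h < d2 \<Longrightarrow> \<bar>integral {- x..- x + h} (\<lambda>t. u (- t)) / h - u x\<bar> < e"
        using N2(2)[OF x2 e] by auto
      let ?d = "min (x - l) (min d1 d2)"
      have "\<bar>(?G (x + h) - ?G x) / h - u x\<bar> < e" if h: "h \<noteq> 0" "\<bar>h\<bar> < ?d" for h
      proof (cases "h > 0")
        case True
        then show ?thesis
          using d1(2)[of h] h primitive_diff_eq_integral[OF u, of l x "x + h"] \<open>l < x\<close> by simp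
      next
        case False
        have "integral {- x..- x + - h} (\<lambda>t. u (- t)) = integral {x + h..x} u"
          using Henstock_Kurzweil_Integration.integral_reflect_real[where f = u and a = "x + h" and b = x]
          by simp
        also have "\<dots> = - (?G (x + h) - ?G x)"
          using primitive_diff_eq_integral[OF u, of l "x + h" x] h False by simp
        finally have "integral {- x..- x + - h} (\<lambda>t. u (- t)) / - h = (?G (x + h) - ?G x) / h"
          by (simp only: minus_divide_left[symmetric] minus_divide_right[symmetric] minus_minus)
        then show ?thesis
          using d2(2)[of "- h"] h False by simp
      qed
      then show "\<exists>s>0. \<forall>h. h \<noteq> 0 \<and> dist h 0 < s \<longrightarrow> dist ((?G (x + h) - ?G x) / h) (u x) < e"
        using d1(1) d2(1) \<open>l < x\<close> by (intro exI[of _ ?d]) (auto simp: dist_real_def)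
    qed
  qed
qed

lemma primitive_has_derivative_isCont:
  fixes u :: "real \<Rightarrow> real"
  assumes u: "integrable lborel u" and "l < x" and cont: "isCont u x"
  shows "((\<lambda>y. LBINT t:{l<..y}. u t) has_real_derivative u x) (at x)"
proof -
  define c where "c = (l + x) / 2"
  have c: "l < c" "c < x" using \<open>l < x\<close> by (auto simp: c_def)
  have at: "at x within {c..x + 1} = at x"
    using c by (intro at_within_interior) auto
  have "((\<lambda>y. integral {c..y} u) has_vector_derivative u x) (at x within ({c..x + 1} - {}))"
    using c cont by (intro integral_has_vector_derivative_continuous_at integrable_on_interval[OF u])
      (auto intro: continuous_at_imp_continuous_at_within)
  then have "((\<lambda>y. (LBINT t:{l<..c}. u t) + integral {c..y} u) has_real_derivative 0 + u x) (at x)"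
    by (intro DERIV_add DERIV_const) (simp add: at has_real_derivative_iff_has_vector_derivative)
  moreover have "(LBINT t:{l<..c}. u t) + integral {c..y} u = (LBINT t:{l<..y}. u t)"
    if "y \<in> {c<..}" for y
    using primitive_diff_eq_integral[OF u, of l c y] c that by simp
  ultimately show ?thesis
    using c by (auto intro: has_field_derivative_transform_within_open[of _ _ x "{c<..}"])
qed

lemma primitive_increment_le:
  fixes u :: "real \<Rightarrow> real"
  assumes u: "integrable lborel u" and "l \<le> x" "x \<le> y"
    and B: "\<And>t. x \<le> t \<Longrightarrow> t \<le> y \<Longrightarrow> \<bar>u t\<bar> \<le> B"
  shows "\<bar>(LBINT t:{l<..y}. u t) - (LBINT t:{l<..x}. u t)\<bar> \<le> B * (y - x)"
proof -
  have "0 \<le> B" using B[of x] \<open>x \<le> y\<close> by (meson abs_ge_zero order.trans order.refl)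
  then show ?thesis
    using has_integral_bound[of B u "integral {x..y} u" x y] B \<open>x \<le> y\<close>
      integrable_integral[OF integrable_on_interval[OF u, of x y]]
    by (simp add: primitive_diff_eq_integral[OF assms(1-3)])
qed

lemma set_integral_split_tail:
  fixes u :: "real \<Rightarrow> real"
  assumes u: "integrable lborel u" and "l \<le> x"
  shows "(LBINT t:{l<..}. u t) = (LBINT t:{l<..x}. u t) + (LBINT t:{x<..}. u t)"
proof -
  note si = set_integrable_lborel[OF u]
  have "{l<..} = {l<..x} \<union> {x<..}" using assms by auto
  then show ?thesis
    using set_integral_Un[of "{l<..x}" "{x<..}" lborel u] si[of "{l<..x}"] si[of "{x<..}"]
    by (simp add: disjoint_iff)
qed

lemma primitive_tendsto_0_at_right:
  fixes u :: "real \<Rightarrow> real"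
  assumes u: "integrable lborel u"
  shows "((\<lambda>y. LBINT t:{l<..y}. u t) \<longlongrightarrow> 0) (at_right l)"
proof -
  let ?G = "\<lambda>y. LBINT t:{l<..y}. u t"
  note si = set_integrable_lborel[OF u]
  have "((\<lambda>y. LBINT t:{y..l + 1}. u t) \<longlongrightarrow> ?G (l + 1)) (at_right l)"
    by (rule tendsto_set_lebesgue_integral_at_right) (auto intro: si)
  then have "((\<lambda>y. ?G (l + 1) - (LBINT t:{y..l + 1}. u t)) \<longlongrightarrow> ?G (l + 1) - ?G (l + 1)) (at_right l)"
    by (intro tendsto_intros)
  moreover have "\<forall>\<^sub>F y in at_right l. ?G (l + 1) - (LBINT t:{y..l + 1}. u t) = ?G y"
    unfolding eventually_at_right_field
  proof (intro exI[of _ "l + 1"] conjI allI impI)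
    fix y assume "l < y" "y < l + 1"
    then show "?G (l + 1) - (LBINT t:{y..l + 1}. u t) = ?G y"
      using primitive_diff_eq_integral[OF u, of l y "l + 1"]
        set_borel_integral_eq_integral(2)[OF si, of "{y..l + 1}"] by simp
  qed simp
  ultimately show ?thesis
    using Lim_transform_eventually by fastforce
qed

lemma tail_integral_tendsto_0:
  fixes u :: "real \<Rightarrow> real"
  assumes u: "integrable lborel u"
  shows "((\<lambda>y. LBINT t:{y<..}. u t) \<longlongrightarrow> 0) at_top"
proof -
  note si = set_integrable_lborel[OF u]
  let ?T = "LBINT t:{0..}. u t"
  have "((\<lambda>y. LBINT t:{0..y}. u t) \<longlongrightarrow> ?T) at_top"
    by (rule tendsto_set_lebesgue_integral_at_top) (auto intro: si)
  then have "((\<lambda>y. ?T - (LBINT t:{0..y}. u t)) \<longlongrightarrow> ?T - ?T) at_top"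
    by (intro tendsto_intros)
  moreover have tail: "?T - (LBINT t:{0..y}. u t) = (LBINT t:{y<..}. u t)" if "0 \<le> y" for y
  proof -
    have "{0..} = {0..y} \<union> {y<..}" using that by auto
    then show ?thesis
      using set_integral_Un[of "{0..y}" "{y<..}" lborel u] si[of "{0..y}"] si[of "{y<..}"]
      by (simp add: disjoint_iff)
  qed
  then have "\<forall>\<^sub>F y in at_top. ?T - (LBINT t:{0..y}. u t) = (LBINT t:{y<..}. u t)"
    by (intro eventually_mono[OF eventually_ge_at_top[of 0]] tail)
  ultimately show ?thesis
    using Lim_transform_eventually by fastforce
qed

section \<open>The integrating factor of the Stein equation\<close>

definition gig_drift :: "real \<Rightarrow> real \<Rightarrow> real \<Rightarrow> real \<Rightarrow> real" where
  "gig_drift p a b x = b / 2 + (p + 1) * x - a / 2 * x\<^sup>2"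

lemma gig_drift_antimono:
  assumes "a > 0" "p \<le> - 1" "0 \<le> x" "x \<le> y"
  shows "gig_drift p a b y \<le> gig_drift p a b x"
proof -
  have "(p + 1) * y \<le> (p + 1) * x"
    using assms by (intro mult_left_mono_neg) auto
  moreover have "a / 2 * x\<^sup>2 \<le> a / 2 * y\<^sup>2"
    using assms by (intro mult_left_mono power_mono) auto
  ultimately show ?thesis by (simp add: gig_drift_def)
qed

lemma gig_density_nonneg: "0 \<le> gig_density p a b x"
proof -
  have "0 \<le> bessel_K p (sqrt (a * b))"
    unfolding bessel_K_def set_lebesgue_integral_def
    by (intro Bochner_Integration.integral_nonneg) auto
  then show ?thesis
    by (simp add: gig_density_def)
qed

lemma gig_density_nonpos_arg: "x \<le> 0 \<Longrightarrow> gig_density p a b x = 0"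
  by (simp add: gig_density_def)

lemma borel_measurable_gig_density [measurable]: "gig_density p a b \<in> borel_measurable borel"
  unfolding gig_density_def[abs_def] by measurable

lemma gig_density_has_derivative:
  assumes x: "x > 0"
  shows "(gig_density p a b has_real_derivative
           gig_density p a b x * ((p - 1) / x - a / 2 + b / (2 * x\<^sup>2))) (at x)"
proof -
  define C where "C = (a / b) powr (p / 2) / (2 * bessel_K p (sqrt (a * b)))"
  let ?e = "\<lambda>x. exp (- (1 / 2) * (a * x + b / x))"
  have "((\<lambda>x. b / x) has_real_derivative - b / (x * x)) (at x)"
    using DERIV_divide[OF DERIV_const DERIV_ident, of x b] x by simp
  then have "((\<lambda>x. - (1 / 2) * (a * x + b / x)) has_real_derivative
      - (1 / 2) * (a * 1 + - b / (x * x))) (at x)"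
    by (intro DERIV_cmult DERIV_add DERIV_ident)
  then have "(?e has_real_derivative ?e x * (- (1 / 2) * (a - b / x\<^sup>2))) (at x)"
    by (rule DERIV_fun_exp[THEN DERIV_cong]) (simp add: power2_eq_square)
  then have "((\<lambda>x. C * x powr (p - 1) * ?e x) has_real_derivative
      C * ((p - 1) * x powr (p - 1 - 1)) * ?e x
      + ?e x * (- (1 / 2) * (a - b / x\<^sup>2)) * (C * x powr (p - 1))) (at x)"
    using x by (intro DERIV_mult DERIV_cmult has_real_derivative_powr)
  then have "((\<lambda>x. C * x powr (p - 1) * ?e x) has_real_derivative
      C * x powr (p - 1) * ?e x * ((p - 1) / x - a / 2 + b / (2 * x\<^sup>2))) (at x)"
  proof (rule DERIV_cong)
    have "x powr (p - 1 - 1) = x powr (p - 1) / x"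
      using x by (simp add: powr_diff power2_eq_square)
    then show "C * ((p - 1) * x powr (p - 1 - 1)) * ?e x
        + ?e x * (- (1 / 2) * (a - b / x\<^sup>2)) * (C * x powr (p - 1))
        = C * x powr (p - 1) * ?e x * ((p - 1) / x - a / 2 + b / (2 * x\<^sup>2))"
      by (simp add: algebra_simps diff_divide_distrib)
  qed
  moreover have "C * y powr (p - 1) * ?e y = gig_density p a b y" if "y \<in> {0<..}" for y
    using that by (simp add: gig_density_def C_def)
  ultimately show ?thesis
    using x by (auto intro: has_field_derivative_transform_within_open[of _ _ x "{0<..}"])
qed

text \<open>
  In Stein's method \<open>s g\<close> is the function whose derivative is \<open>\<tau> g\<close>; here it is the integrating factor
  of the equation and the denominator of its solution.
\<close>

definition gig_weight :: "real \<Rightarrow> real \<Rightarrow> real \<Rightarrow> real \<Rightarrow> real" where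
  "gig_weight p a b x = stein_s x * gig_density p a b x"

text \<open>
  The logarithmic derivative of \<open>g\<close> is \<open>(p - 1)/x - a/2 + b/(2 x\<^sup>2)\<close>. Multiplied by \<open>x\<^sup>2\<close> it becomes a
  polynomial, and the derivative of \<open>x\<^sup>2\<close> raises its linear coefficient from \<open>p - 1\<close> to \<open>p + 1\<close>.
\<close>

lemma gig_weight_has_derivative:
  assumes x: "x > 0"
  shows "(gig_weight p a b has_real_derivative gig_drift p a b x * gig_density p a b x) (at x)"
proof -
  have "((\<lambda>x. x\<^sup>2 * gig_density p a b x) has_real_derivative
      2 * x * gig_density p a b x
      + x\<^sup>2 * (gig_density p a b x * ((p - 1) / x - a / 2 + b / (2 * x\<^sup>2)))) (at x)"
    by (auto intro!: derivative_eq_intros gig_density_has_derivative[OF x])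
  moreover have "2 * x * gig_density p a b x
      + x\<^sup>2 * (gig_density p a b x * ((p - 1) / x - a / 2 + b / (2 * x\<^sup>2)))
      = gig_drift p a b x * gig_density p a b x"
    using x by (simp add: gig_drift_def field_simps power2_eq_square)
  ultimately show ?thesis
    by (simp add: gig_weight_def[abs_def] stein_s_def)
qed

text \<open>
  For \<open>p \<le> -1\<close> the power \<open>x powr (p + 1)\<close> in \<open>k\<close> is at most \<open>1\<close> on \<open>[1,\<infinity>)\<close>, which leaves the
  exponential decay.
\<close>

lemma gig_weight_tendsto_0_at_top:
  assumes "a > 0" "b > 0" "p \<le> - 1"
  shows "(gig_weight p a b \<longlongrightarrow> 0) at_top"
proof -
  define C where "C = (a / b) powr (p / 2) / (2 * bessel_K p (sqrt (a * b)))"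
  have C: "norm (gig_weight p a b x) \<le> \<bar>C\<bar> * exp (- (a / 2) * x)" if "x \<ge> 1" for x
  proof -
    have "x\<^sup>2 * x powr (p - 1) = x powr (p + 1)"
      using that powr_add[of x 2 "p - 1"] by (simp add: add.commute)
    also have "\<dots> \<le> 1"
      using that assms(3) powr_mono[of "p + 1" 0 x] by simp
    finally have 1: "x\<^sup>2 * x powr (p - 1) \<le> 1" .
    have 2: "exp (- (1 / 2) * (a * x + b / x)) \<le> exp (- (a / 2) * x)"
      using that assms(2) by simp
    have "norm (gig_weight p a b x)
        = \<bar>C\<bar> * ((x\<^sup>2 * x powr (p - 1)) * exp (- (1 / 2) * (a * x + b / x)))"
      using that by (simp add: gig_weight_def stein_s_def gig_density_def C_def abs_mult mult_ac)
    also have "\<dots> \<le> \<bar>C\<bar> * (1 * exp (- (a / 2) * x))"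
      by (intro mult_left_mono mult_mono 1 2) auto
    finally show ?thesis by simp
  qed
  have lim: "((\<lambda>x. \<bar>C\<bar> * exp (- (a / 2) * x)) \<longlongrightarrow> \<bar>C\<bar> * 0) at_top"
    using assms(1)
    by (intro tendsto_mult_left filterlim_compose[OF exp_at_bot]
          filterlim_tendsto_neg_mult_at_bot[OF tendsto_const] filterlim_ident) auto
  have "\<forall>\<^sub>F x in at_top. norm (gig_weight p a b x) \<le> \<bar>C\<bar> * exp (- (a / 2) * x)"
    using eventually_ge_at_top[of "1::real"] by eventually_elim (rule C)
  then show ?thesis
    using lim unfolding mult_zero_right by (rule Lim_null_comparison)
qed

section \<open>The Stein solution\<close>

text \<open>
  The only property of the normalising factor that enters is that \<open>g\<close> has mass one, and this is what
  a random variable with density \<open>g\<close> provides (\<open>gig_if_distributed\<close>).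
\<close>

locale gig =
  fixes p a b :: real
  assumes a_pos: "a > 0" and b_pos: "b > 0"
    and density_integrable: "integrable lborel (gig_density p a b)"
    and density_mass: "(LBINT t. gig_density p a b t) = 1"
begin

abbreviation "g \<equiv> gig_density p a b"
abbreviation "k \<equiv> gig_weight p a b"
abbreviation "drift \<equiv> gig_drift p a b"
abbreviation "lower x \<equiv> LBINT t:{0<..x}. g t"
abbreviation "upper x \<equiv> LBINT t:{x<..}. g t"

text \<open>
  The normalising constant is a quotient by a Bessel integral that is nonnegative, with value \<open>0\<close> if
  it diverges; division by \<open>0\<close> yields \<open>0\<close>. So the constant is nonnegative, and it is nonzero because
  otherwise \<open>g\<close> would vanish identically, against its having mass one.
\<close>

lemma density_pos:
  assumes "x > 0"
  shows "g x > 0"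
proof -
  define C where "C = (a / b) powr (p / 2) / (2 * bessel_K p (sqrt (a * b)))"
  have g: "g x = C * x powr (p - 1) * exp (- (1 / 2) * (a * x + b / x))" if "x > 0" for x
    using that by (simp add: gig_density_def C_def)
  have "C \<noteq> 0"
  proof
    assume "C = 0"
    then have "g x = 0" for x
      by (cases "x > 0") (simp_all add: g gig_density_nonpos_arg)
    then show False using density_mass by simp
  qed
  then have "g x \<noteq> 0" using g[OF assms] assms by simp
  then show ?thesis using gig_density_nonneg[of p a b x] by simp
qed

lemma weight_pos: "x > 0 \<Longrightarrow> k x > 0"
  by (simp add: gig_weight_def stein_s_def density_pos)

lemma density_isCont: "x > 0 \<Longrightarrow> isCont g x"
  by (rule DERIV_isCont[OF gig_density_has_derivative])

lemma set_integral_positive_axis: "(LBINT t:{0<..}. g t * r t) = (LBINT t. g t * r t)"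
  unfolding set_lebesgue_integral_def
  by (rule Bochner_Integration.integral_cong) (auto simp: gig_density_nonpos_arg indicator_def)

lemma upper_eq: "x \<ge> 0 \<Longrightarrow> upper x = 1 - lower x"
  using set_integral_split_tail[OF density_integrable, of 0 x] density_mass
    set_integral_positive_axis[of "\<lambda>_. 1"] by simp

lemma lower_has_derivative:
  assumes "x > 0"
  shows "((\<lambda>y. lower y) has_real_derivative g x) (at x)"
  by (rule primitive_has_derivative_isCont[OF density_integrable assms density_isCont[OF assms]])

lemma upper_has_derivative:
  assumes "x > 0"
  shows "((\<lambda>y. upper y) has_real_derivative - g x) (at x)"
proof -
  have "((\<lambda>y. 1 - lower y) has_real_derivative - g x) (at x)"
    by (auto intro!: derivative_eq_intros lower_has_derivative[OF assms])
  then show ?thesis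
    by (rule has_field_derivative_transform_within_open[of _ _ x "{0<..}"])
       (use assms in \<open>auto simp: upper_eq\<close>)
qed

text \<open>
  Since \<open>\<tau>\<close> is decreasing, \<open>\<tau>(x) \<integral>\<^sub>0\<^sup>x g \<le> \<integral>\<^sub>0\<^sup>x \<tau> g = \<integral>\<^sub>0\<^sup>x k' \<le> k(x)\<close>. To avoid the boundary value of \<open>k\<close> at
  \<open>0\<close>, the argument is run on the increasing function \<open>y \<mapsto> k(y) - \<tau>(x) P(y)\<close> on \<open>(0,x]\<close>, where \<open>k > 0\<close>
  and \<open>P(y)\<close> tends to \<open>0\<close>.
\<close>

lemma drift_mult_lower_le_weight:
  assumes p: "p \<le> - 1" and x: "x > 0"
  shows "drift x * lower x \<le> k x"
proof -
  let ?D = "\<lambda>y. k y - drift x * lower y"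
  have D: "?D e \<le> ?D x" if e: "0 < e" "e \<le> x" for e
  proof (rule DERIV_nonneg_imp_nondecreasing[OF e(2)])
    fix y assume y: "e \<le> y" "y \<le> x"
    then have "y > 0" using e by simp
    then have "(?D has_real_derivative drift y * g y - drift x * g y) (at y)"
      by (auto intro!: derivative_eq_intros gig_weight_has_derivative lower_has_derivative)
    moreover have "drift x * g y \<le> drift y * g y"
      using gig_drift_antimono[OF a_pos p, of y x b] \<open>y > 0\<close> y
      by (intro mult_right_mono gig_density_nonneg) auto
    ultimately show "\<exists>d. (?D has_real_derivative d) (at y) \<and> 0 \<le> d"
      by (intro exI conjI) auto
  qed
  have "((\<lambda>e. - (drift x * lower e)) \<longlongrightarrow> - (drift x * 0)) (at_right 0)"
    by (intro tendsto_intros primitive_tendsto_0_at_right density_integrable)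
  moreover have "\<forall>\<^sub>F e in at_right 0. - (drift x * lower e) \<le> ?D x"
    unfolding eventually_at_right_field
  proof (intro exI[of _ x] conjI allI impI x)
    fix e assume e: "0 < e" "e < x"
    then show "- (drift x * lower e) \<le> ?D x"
      using D[of e] weight_pos[of e] by simp
  qed
  ultimately have "- (drift x * 0) \<le> ?D x"
    by (rule tendsto_upperbound) simp
  then show ?thesis by simp
qed

text \<open>The mirror image of the preceding bound, with \<open>y \<mapsto> k(y) + \<tau>(x) Q(y)\<close> decreasing on \<open>[x,\<infinity>)\<close>.\<close>

lemma neg_drift_mult_upper_le_weight:
  assumes p: "p \<le> - 1" and x: "x > 0"
  shows "- drift x * upper x \<le> k x"
proof -
  let ?E = "\<lambda>y. k y + drift x * upper y"
  have E: "?E y \<le> ?E x" if y: "x \<le> y" for y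
  proof (rule DERIV_nonpos_imp_nonincreasing[OF y])
    fix z assume z: "x \<le> z" "z \<le> y"
    then have "z > 0" using x by simp
    then have "(?E has_real_derivative drift z * g z + drift x * - g z) (at z)"
      by (auto intro!: derivative_eq_intros gig_weight_has_derivative upper_has_derivative)
    moreover have "drift z * g z \<le> drift x * g z"
      using gig_drift_antimono[OF a_pos p, of x z b] x z
      by (intro mult_right_mono gig_density_nonneg) auto
    ultimately show "\<exists>d. (?E has_real_derivative d) (at z) \<and> d \<le> 0"
      by (intro exI conjI) auto
  qed
  have "((\<lambda>y. drift x * upper y) \<longlongrightarrow> drift x * 0) at_top"
    by (intro tendsto_intros tail_integral_tendsto_0 density_integrable)
  moreover have "\<forall>\<^sub>F y in at_top. drift x * upper y \<le> ?E x"
    using eventually_ge_at_top[of x]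
  proof eventually_elim
    fix y assume "x \<le> y"
    then show "drift x * upper y \<le> ?E x"
      using E[of y] weight_pos[of y] x by simp
  qed
  ultimately have "drift x * 0 \<le> ?E x"
    by (rule tendsto_upperbound) simp
  then show ?thesis by simp
qed

text \<open>
  As \<open>k' = \<tau> g\<close>, the derivative of \<open>P / k\<close> is \<open>g (k - \<tau> P) / k\<^sup>2\<close> and that of \<open>Q / k\<close> is
  \<open>-g (k + \<tau> Q) / k\<^sup>2\<close>; their signs are the content of the two bounds above.
\<close>

lemma lower_ratio_mono:
  assumes p: "p \<le> - 1" and xy: "0 < x" "x \<le> y"
  shows "lower x / k x \<le> lower y / k y"
proof (rule DERIV_nonneg_imp_nondecreasing[OF xy(2)])
  fix z assume "x \<le> z" "z \<le> y"
  then have z: "z > 0" using xy by simp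
  have "((\<lambda>z. lower z / k z) has_real_derivative
      (g z * k z - lower z * (drift z * g z)) / (k z * k z)) (at z)"
    using weight_pos[OF z]
    by (intro DERIV_divide gig_weight_has_derivative lower_has_derivative z) simp
  moreover have "g z * k z - lower z * (drift z * g z) = g z * (k z - drift z * lower z)"
    by (simp add: algebra_simps)
  then have "(g z * k z - lower z * (drift z * g z)) / (k z * k z) \<ge> 0"
    using drift_mult_lower_le_weight[OF p z] gig_density_nonneg[of p a b z] by simp
  ultimately show "\<exists>d. ((\<lambda>z. lower z / k z) has_real_derivative d) (at z) \<and> 0 \<le> d"
    by blast
qed

lemma upper_ratio_antimono:
  assumes p: "p \<le> - 1" and xy: "0 < x" "x \<le> y"
  shows "upper y / k y \<le> upper x / k x"
proof (rule DERIV_nonpos_imp_nonincreasing[OF xy(2)])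
  fix z assume "x \<le> z" "z \<le> y"
  then have z: "z > 0" using xy by simp
  have "((\<lambda>z. upper z / k z) has_real_derivative
      (- g z * k z - upper z * (drift z * g z)) / (k z * k z)) (at z)"
    using weight_pos[OF z]
    by (intro DERIV_divide gig_weight_has_derivative upper_has_derivative z) simp
  moreover have "- g z * k z - upper z * (drift z * g z) = - (g z * (k z - - drift z * upper z))"
    by (simp add: algebra_simps)
  then have "(- g z * k z - upper z * (drift z * g z)) / (k z * k z) \<le> 0"
    using neg_drift_mult_upper_le_weight[OF p z] gig_density_nonneg[of p a b z]
    by (simp add: divide_nonpos_nonneg)
  ultimately show "\<exists>d. ((\<lambda>z. upper z / k z) has_real_derivative d) (at z) \<and> d \<le> 0"
    by blast
qed

lemma stein_f_eq: "gig_stein_f p a b r x = (LBINT t:{0<..x}. g t * r t) / k x"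
  by (simp add: gig_stein_f_def gig_weight_def)

lemma stein_f_eq_tail:
  assumes int: "integrable lborel (\<lambda>t. g t * r t)" and centred: "(LBINT t. g t * r t) = 0"
    and "x \<ge> 0"
  shows "gig_stein_f p a b r x = - (LBINT t:{x<..}. g t * r t) / k x"
proof -
  have "(LBINT t:{0<..x}. g t * r t) = - (LBINT t:{x<..}. g t * r t)"
    using set_integral_split_tail[OF int \<open>x \<ge> 0\<close>] set_integral_positive_axis[of r] centred by simp
  then show ?thesis by (simp add: stein_f_eq)
qed

text \<open>
  The quotient rule for \<open>f = G / k\<close> with \<open>k' = \<tau> g\<close> and \<open>k = x\<^sup>2 g\<close>. This is pointwise in \<open>x\<close>, so it
  covers both the almost everywhere statement and the one at points of continuity.
\<close>

lemma stein_eq_at_if_primitive_derivative: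
  assumes x: "x > 0"
    and G: "((\<lambda>y. LBINT t:{0<..y}. g t * r t) has_real_derivative g x * r x) (at x)"
  shows "gig_stein_eq_at p a b r (gig_stein_f p a b r) x"
proof -
  let ?G = "\<lambda>y. LBINT t:{0<..y}. g t * r t"
  have k: "k x \<noteq> 0" "k x = x\<^sup>2 * g x" "g x \<noteq> 0"
    using weight_pos[OF x] density_pos[OF x] by (auto simp: gig_weight_def stein_s_def)
  let ?f' = "(g x * r x * k x - ?G x * (drift x * g x)) / (k x * k x)"
  have "((\<lambda>y. ?G y / k y) has_real_derivative ?f') (at x)"
    by (intro DERIV_divide gig_weight_has_derivative x G k)
  then have "(gig_stein_f p a b r has_real_derivative ?f') (at x)"
    by (simp add: stein_f_eq[abs_def])
  moreover have "x\<^sup>2 * ?f' + drift x * (?G x / k x) = r x"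
    using x k(3) unfolding k(2) by (simp add: field_simps power2_eq_square)
  ultimately show ?thesis
    unfolding gig_stein_eq_at_def gig_drift_def[symmetric] stein_f_eq[symmetric] by blast
qed

text \<open>
  On a compact interval in \<open>(0,\<infinity>)\<close> the primitive \<open>G\<close> is Lipschitz because its integrand is bounded,
  \<open>1 / k\<close> is Lipschitz because it is continuously differentiable, and both are bounded; hence so is
  their product.
\<close>

lemma stein_f_lipschitz:
  assumes int: "integrable lborel (\<lambda>t. g t * r t)"
    and R: "\<And>t. t > 0 \<Longrightarrow> \<bar>r t\<bar> \<le> R" and "0 < c"
  shows "\<exists>L. L-lipschitz_on {c..d} (gig_stein_f p a b r)"
proof (cases "c \<le> d")
  case False
  then have "{c..d} = {}" by simp
  then show ?thesis by (auto intro!: exI[of _ 0] simp: lipschitz_on_def)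
next
  case True
  let ?G = "\<lambda>y. LBINT t:{0<..y}. g t * r t"
  have pos: "x > 0" if "x \<in> {c..d}" for x using that \<open>0 < c\<close> by simp
  have contg: "continuous_on {c..d} g"
    using density_isCont pos by (intro continuous_at_imp_continuous_on) auto
  have contk: "continuous_on {c..d} k"
    using DERIV_isCont[OF gig_weight_has_derivative] pos
    by (intro continuous_at_imp_continuous_on) auto
  have contdrift: "continuous_on {c..d} drift"
    unfolding gig_drift_def by (intro continuous_intros)
  have bound: "\<exists>B. \<forall>x\<in>{c..d}. \<bar>u x\<bar> \<le> B" if "continuous_on {c..d} u" for u :: "real \<Rightarrow> real"
    using compact_imp_bounded[OF compact_continuous_image[OF that compact_Icc]]
    unfolding bounded_iff by auto
  obtain B where B: "\<And>x. x \<in> {c..d} \<Longrightarrow> \<bar>g x\<bar> \<le> B"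
    using bound[OF contg] by blast
  have B0: "0 \<le> B" using B[of c] True by (meson abs_ge_zero atLeastAtMost_iff order.refl order.trans)
  have R0: "0 \<le> R" using R[of 1] by simp
  have G: "\<bar>?G x - ?G y\<bar> \<le> (B * R) * \<bar>x - y\<bar>" if "x \<in> {c..d}" "y \<in> {c..d}" for x y
  proof -
    have *: "\<bar>?G y - ?G x\<bar> \<le> (B * R) * (y - x)" if xy: "x \<in> {c..d}" "y \<in> {c..d}" "x \<le> y" for x y
    proof (rule primitive_increment_le[OF int _ xy(3)])
      show "0 \<le> x" using pos[OF xy(1)] by simp
      fix t assume "x \<le> t" "t \<le> y"
      then have "t \<in> {c..d}" "t > 0" using xy pos[OF xy(1)] by auto
      then show "\<bar>g t * r t\<bar> \<le> B * R"
        unfolding abs_mult using B0 by (intro mult_mono B R) auto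
    qed
    show ?thesis
      using *[OF that] *[OF that(2,1)] by (cases "x \<le> y") (simp_all add: abs_minus_commute)
  qed
  have kpos: "k x > 0" if "x \<in> {c..d}" for x using weight_pos pos that by blast
  obtain A where A: "\<And>x. x \<in> {c..d} \<Longrightarrow> \<bar>inverse (k x)\<bar> \<le> A"
    using bound[OF continuous_on_inverse[OF contk]] kpos by fastforce
  have "continuous_on {c..d} (\<lambda>x. - (inverse (k x) * (drift x * g x) * inverse (k x)))"
    using kpos by (intro continuous_intros contk contdrift contg) (metis less_irrefl)+
  from bound[OF this] obtain D where
    D: "\<And>x. x \<in> {c..d} \<Longrightarrow> \<bar>- (inverse (k x) * (drift x * g x) * inverse (k x))\<bar> \<le> D" by blast
  have K: "\<bar>inverse (k x) - inverse (k y)\<bar> \<le> D * \<bar>x - y\<bar>" if "x \<in> {c..d}" "y \<in> {c..d}" for x y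
  proof -
    have "norm (inverse (k x) - inverse (k y)) \<le> D * norm (x - y)"
    proof (rule field_differentiable_bound[of "{c..d}"])
      fix z assume z: "z \<in> {c..d}"
      show "((\<lambda>x. inverse (k x)) has_real_derivative
          - (inverse (k z) * (drift z * g z) * inverse (k z))) (at z within {c..d})"
        using kpos[OF z]
        by (intro DERIV_inverse' has_field_derivative_at_within[OF gig_weight_has_derivative] pos z)
          simp
      show "norm (- (inverse (k z) * (drift z * g z) * inverse (k z))) \<le> D" using D[OF z] by simp
    qed (use that in auto)
    then show ?thesis by simp
  qed
  obtain T where T: "\<And>x. x \<in> {c..d} \<Longrightarrow> \<bar>?G x\<bar> \<le> T"
  proof
    fix x assume x: "x \<in> {c..d}"
    have "\<bar>?G x\<bar> \<le> \<bar>?G x - ?G c\<bar> + \<bar>?G c\<bar>" by simp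
    also have "\<bar>?G x - ?G c\<bar> \<le> (B * R) * (d - c)"
      using G[of x c] x True B0 R0 mult_left_mono[of "\<bar>x - c\<bar>" "d - c" "B * R"] by force
    finally show "\<bar>?G x\<bar> \<le> (B * R) * (d - c) + \<bar>?G c\<bar>" by simp
  qed
  have T0: "0 \<le> T" using T[of c] True by (meson abs_ge_zero atLeastAtMost_iff order.refl order.trans)
  have A0: "0 \<le> A" using A[of c] True by (meson abs_ge_zero atLeastAtMost_iff order.refl order.trans)
  have D0: "0 \<le> D" using D[of c] True by (meson abs_ge_zero atLeastAtMost_iff order.refl order.trans)
  have "(B * R * A + T * D)-lipschitz_on {c..d} (gig_stein_f p a b r)"
  proof (rule lipschitz_onI)
    fix x y assume xy: "x \<in> {c..d}" "y \<in> {c..d}"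
    have eq: "gig_stein_f p a b r x - gig_stein_f p a b r y
        = (?G x - ?G y) * inverse (k x) + ?G y * (inverse (k x) - inverse (k y))"
      unfolding stein_f_eq by (simp add: divide_inverse algebra_simps)
    have "\<bar>gig_stein_f p a b r x - gig_stein_f p a b r y\<bar>
        \<le> \<bar>?G x - ?G y\<bar> * \<bar>inverse (k x)\<bar> + \<bar>?G y\<bar> * \<bar>inverse (k x) - inverse (k y)\<bar>"
      unfolding eq abs_mult[symmetric] by (rule abs_triangle_ineq)
    also have "\<dots> \<le> (B * R * \<bar>x - y\<bar>) * A + T * (D * \<bar>x - y\<bar>)"
      by (rule add_mono[OF mult_mono[OF G[OF xy] A[OF xy(1)]] mult_mono[OF T[OF xy(2)] K[OF xy]]])
        (use B0 R0 T0 in simp_all)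
    finally show "dist (gig_stein_f p a b r x) (gig_stein_f p a b r y)
        \<le> (B * R * A + T * D) * dist x y"
      by (simp add: dist_real_def algebra_simps)
  qed (use A0 B0 R0 T0 D0 in auto)
  then show ?thesis by blast
qed

lemma stein_f_solution_ae:
  assumes int: "integrable lborel (\<lambda>t. g t * r t)"
    and R: "\<And>t. t > 0 \<Longrightarrow> \<bar>r t\<bar> \<le> R"
  shows "gig_stein_solution_ae p a b r (gig_stein_f p a b r)"
  unfolding gig_stein_solution_ae_def
proof (intro conjI allI impI)
  fix c d :: real assume "0 < c"
  then show "\<exists>L. L-lipschitz_on {c..d} (gig_stein_f p a b r)"
    using stein_f_lipschitz[OF int] R by blast
next
  show "AE x in lborel. x > 0 \<longrightarrow> gig_stein_eq_at p a b r (gig_stein_f p a b r) x"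
    using primitive_has_derivative_AE[OF int]
    by eventually_elim (auto intro: stein_eq_at_if_primitive_derivative)
next
  fix x :: real assume x: "x > 0" and "isCont r x"
  then have "isCont (\<lambda>t. g t * r t) x"
    using density_isCont[OF x] by (intro continuous_intros)
  from primitive_has_derivative_isCont[OF int x this]
  show "gig_stein_eq_at p a b r (gig_stein_f p a b r) x"
    by (rule stein_eq_at_if_primitive_derivative[OF x])
qed

lemma set_integral_density_bound:
  assumes int: "integrable lborel (\<lambda>t. g t * r t)" and A: "A \<in> sets borel" "A \<subseteq> {0<..}"
    and R: "\<And>t. t > 0 \<Longrightarrow> \<bar>r t\<bar> \<le> R"
  shows "\<bar>LBINT t:A. g t * r t\<bar> \<le> R * (LBINT t:A. g t)"
proof -
  note si = set_integrable_lborel[OF _ A(1)]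
  have "\<bar>LBINT t:A. g t * r t\<bar> \<le> (LBINT t:A. \<bar>g t * r t\<bar>)"
    using set_integral_norm_bound[OF si[OF int]] by simp
  also have "\<dots> \<le> (LBINT t:A. R * g t)"
  proof (rule set_integral_mono)
    show "set_integrable lborel A (\<lambda>t. \<bar>g t * r t\<bar>)" "set_integrable lborel A (\<lambda>t. R * g t)"
      using int density_integrable by (auto intro!: si)
    fix t assume "t \<in> A"
    then show "\<bar>g t * r t\<bar> \<le> R * g t"
      using R[of t] A(2) gig_density_nonneg[of p a b t]
      by (auto simp: abs_mult mult.commute intro!: mult_right_mono)
  qed
  finally show ?thesis by simp
qed

text \<open>
  To the left of \<open>c\<close> the formula over \<open>(0,x]\<close> is used, to the right the one over \<open>(x,\<infinity>)\<close>; by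
  monotonicity the ratios \<open>P / k\<close> and \<open>Q / k\<close> are then largest at \<open>c\<close>.
\<close>

lemma stein_f_bound:
  assumes p: "p \<le> - 1"
    and int: "integrable lborel (\<lambda>t. g t * r t)" and centred: "(LBINT t. g t * r t) = 0"
    and R: "\<And>t. t > 0 \<Longrightarrow> \<bar>r t\<bar> \<le> R" and x: "x > 0" and c: "c > 0"
  shows "\<bar>gig_stein_f p a b r x\<bar> \<le> R * max (lower c / k c) (upper c / k c)"
proof -
  have R0: "0 \<le> R" using R[of 1] by simp
  have kx: "k x > 0" by (rule weight_pos[OF x])
  show ?thesis
  proof (cases "x \<le> c")
    case True
    have "\<bar>gig_stein_f p a b r x\<bar> \<le> R * lower x / k x"
      unfolding stein_f_eq abs_divide using kx
      by (auto intro!: divide_right_mono set_integral_density_bound[OF int] R)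
    also have "\<dots> = R * (lower x / k x)" by simp
    also have "\<dots> \<le> R * max (lower c / k c) (upper c / k c)"
      using lower_ratio_mono[OF p x True] R0 by (intro mult_left_mono) auto
    finally show ?thesis .
  next
    case False
    have "\<bar>gig_stein_f p a b r x\<bar> \<le> R * upper x / k x"
      unfolding stein_f_eq_tail[OF int centred less_imp_le[OF x]]
      unfolding abs_divide abs_minus_cancel using kx x
      by (auto intro!: divide_right_mono set_integral_density_bound[OF int] R)
    also have "\<dots> = R * (upper x / k x)" by simp
    also have "\<dots> \<le> R * max (lower c / k c) (upper c / k c)"
      using upper_ratio_antimono[OF p c, of x] False R0 by (intro mult_left_mono) auto
    finally show ?thesis .
  qed
qed

text \<open>
  Multiplied by \<open>k\<close>, the difference of two solutions is constant, and boundedness together with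
  \<open>k \<rightarrow> 0\<close> at \<open>\<infinity>\<close> forces this constant to be zero.
\<close>

lemma bounded_stein_solution_unique:
  assumes p: "p \<le> - 1"
    and f1: "gig_stein_solution p a b r f1" "bounded (f1 ` {0<..})"
    and f2: "gig_stein_solution p a b r f2" "bounded (f2 ` {0<..})"
    and x: "x > 0"
  shows "f1 x = f2 x"
proof -
  let ?d = "\<lambda>x. k x * (f1 x - f2 x)"
  have "(?d has_real_derivative 0) (at x within {0<..})" if "x \<in> {0<..}" for x
  proof -
    have x: "x > 0" using that by simp
    have "gig_stein_eq_at p a b r f1 x" "gig_stein_eq_at p a b r f2 x"
      using f1(1) f2(1) x unfolding gig_stein_solution_def by simp_all
    then obtain f1' f2' where
      1: "(f1 has_real_derivative f1') (at x)" "x\<^sup>2 * f1' + drift x * f1 x = r x" and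
      2: "(f2 has_real_derivative f2') (at x)" "x\<^sup>2 * f2' + drift x * f2 x = r x"
      unfolding gig_stein_eq_at_def gig_drift_def by (elim exE conjE)
    have "(?d has_real_derivative (drift x * g x) * (f1 x - f2 x) + (f1' - f2') * k x) (at x)"
      by (intro DERIV_mult gig_weight_has_derivative x DERIV_diff 1 2)
    moreover have "(drift x * g x) * (f1 x - f2 x) + (f1' - f2') * k x
        = g x * ((x\<^sup>2 * f1' + drift x * f1 x) - (x\<^sup>2 * f2' + drift x * f2 x))"
      by (simp add: gig_weight_def stein_s_def algebra_simps)
    ultimately have "(?d has_real_derivative 0) (at x)"
      unfolding 1(2) 2(2) by simp
    then show ?thesis by (rule has_field_derivative_at_within)
  qed
  from has_field_derivative_zero_constant[OF convex_real_interval(3) this]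
  obtain c where "\<forall>x\<in>{0<..}. ?d x = c" ..
  then have c: "?d x = c" if "x > 0" for x
    using that by simp
  obtain B1 where B1: "\<And>x. x > 0 \<Longrightarrow> \<bar>f1 x\<bar> \<le> B1"
    using f1(2) by (auto simp: bounded_iff)
  obtain B2 where B2: "\<And>x. x > 0 \<Longrightarrow> \<bar>f2 x\<bar> \<le> B2"
    using f2(2) by (auto simp: bounded_iff)
  have bound: "norm (?d x) \<le> k x * (B1 + B2)" if "x > 0" for x
  proof -
    have "\<bar>f1 x - f2 x\<bar> \<le> B1 + B2"
      using B1[OF that] B2[OF that] by linarith
    then show ?thesis
      using weight_pos[OF that] by (simp add: abs_mult)
  qed
  have "\<forall>\<^sub>F x in at_top. norm (?d x) \<le> k x * (B1 + B2)"
    using eventually_gt_at_top[of "0::real"] by eventually_elim (rule bound)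
  moreover have "((\<lambda>x. k x * (B1 + B2)) \<longlongrightarrow> 0) at_top"
    by (rule tendsto_mult_left_zero[OF gig_weight_tendsto_0_at_top[OF a_pos b_pos p]])
  ultimately have "(?d \<longlongrightarrow> 0) at_top"
    by (rule Lim_null_comparison)
  moreover have "\<forall>\<^sub>F x in at_top. ?d x = c"
    using eventually_gt_at_top[of "0::real"] by eventually_elim (rule c)
  ultimately have "((\<lambda>_::real. c) \<longlongrightarrow> 0) at_top"
    by (rule Lim_transform_eventually)
  then have "c = 0" by (simp add: tendsto_const_iff)
  with c[OF x] have "k x * (f1 x - f2 x) = 0" by (rule trans)
  then show ?thesis using weight_pos[OF x] by simp
qed

end

section \<open>The law of \<open>W\<close>, and the supremum norm\<close>

lemma abs_le_sup_norm_pos: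
  assumes "bounded (u ` {0<..})" "x > 0"
  shows "\<bar>u x\<bar> \<le> sup_norm_pos u"
  unfolding sup_norm_pos_def
proof (rule cSUP_upper)
  obtain B where "\<And>x. x > 0 \<Longrightarrow> \<bar>u x\<bar> \<le> B"
    using assms(1) by (auto simp: bounded_iff)
  then show "bdd_above ((\<lambda>x. \<bar>u x\<bar>) ` {0<..})"
    by (intro bdd_aboveI2) auto
qed (use assms in simp)

lemma sup_norm_pos_le:
  assumes "\<And>x. x > 0 \<Longrightarrow> \<bar>u x\<bar> \<le> B"
  shows "sup_norm_pos u \<le> B"
  unfolding sup_norm_pos_def
  by (rule cSUP_least) (use assms in \<open>auto intro: exI[of _ 1]\<close>)

lemma gig_alpha_pos:
  assumes "a > 0" "b > 0"
  shows "gig_alpha p a b > 0"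
proof -
  have "\<bar>p + 1\<bar> < sqrt ((p + 1)\<^sup>2 + a * b)"
    using assms by (intro real_less_rsqrt) simp
  then show ?thesis
    using assms by (simp add: gig_alpha_def)
qed

lemma gig_if_distributed:
  assumes "a > 0" "b > 0" "prob_space \<Omega>"
    and D: "distributed \<Omega> lborel W (\<lambda>x. ennreal (gig_density p a b x))"
  shows "gig p a b"
proof
  interpret prob_space \<Omega> by fact
  show "integrable lborel (gig_density p a b)"
    using distributed_integrable[OF D, of "\<lambda>_. 1"] by (simp add: gig_density_nonneg)
  show "(LBINT t. gig_density p a b t) = 1"
    using distributed_integral[OF D, of "\<lambda>_. 1"] by (simp add: gig_density_nonneg prob_space)
qed fact+

text \<open>
  Measurability on the whole line is only given for the extension of \<open>h\<close> by zero; replacing \<open>h\<close> by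
  it changes neither side, as the expectation is restricted to \<open>W > 0\<close> and \<open>g\<close> vanishes on \<open>(-\<infinity>,0]\<close>.
\<close>

lemma expectation_pos_eq:
  assumes D: "distributed \<Omega> lborel W (\<lambda>x. ennreal (gig_density p a b x))"
    and h: "set_borel_measurable borel {0<..} h"
  shows "expectation_pos \<Omega> W h = (LBINT t. gig_density p a b t * h t)"
proof -
  let ?H = "\<lambda>t. indicator {0<..} t *\<^sub>R h t"
  have "expectation_pos \<Omega> W h = (LINT \<omega>|\<Omega>. ?H (W \<omega>))"
    unfolding expectation_pos_def set_lebesgue_integral_def
    by (rule Bochner_Integration.integral_cong) (auto simp: indicator_def)
  also have "\<dots> = (LBINT t. gig_density p a b t * ?H t)"
    using h by (intro distributed_integral[OF D, symmetric])
      (auto simp: set_borel_measurable_def gig_density_nonneg)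
  also have "\<dots> = (LBINT t. gig_density p a b t * h t)"
    by (rule Bochner_Integration.integral_cong) (auto simp: indicator_def gig_density_nonpos_arg)
  finally show ?thesis .
qed

lemma (in gig) integrable_density_mult:
  assumes h: "set_borel_measurable borel {0<..} h" "bounded (h ` {0<..})"
  shows "integrable lborel (\<lambda>t. g t * h t)"
proof -
  let ?H = "\<lambda>t. indicator {0<..} t *\<^sub>R h t"
  obtain B where B: "\<And>x. x > 0 \<Longrightarrow> \<bar>h x\<bar> \<le> B"
    using h(2) by (auto simp: bounded_iff)
  have eq: "(\<lambda>t. g t * h t) = (\<lambda>t. g t * ?H t)"
    by (auto simp: fun_eq_iff indicator_def gig_density_nonpos_arg)
  have meas: "?H \<in> borel_measurable borel"
    using h(1) by (simp add: set_borel_measurable_def)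
  show ?thesis
    unfolding eq
  proof (rule Bochner_Integration.integrable_bound)
    show "integrable lborel (\<lambda>t. B * g t)" using density_integrable by simp
    show "(\<lambda>t. g t * ?H t) \<in> borel_measurable lborel"
      using meas by measurable
    have "norm (g t * ?H t) \<le> norm (B * g t)" for t
      using B[of t] gig_density_nonneg[of p a b t]
      by (cases "t > 0") (auto simp: abs_mult mult.commute intro!: mult_right_mono)
    then show "AE t in lborel. norm (g t * ?H t) \<le> norm (B * g t)" by simp
  qed
qed

theorem theorem3p1:
  fixes p a b :: real
    and \<Omega> :: "'a measure" and W :: "'a \<Rightarrow> real"
    and h r f\<^sub>h :: "real \<Rightarrow> real"
  assumes "a > 0" and "b > 0"
    and "prob_space \<Omega>"
    and "distributed \<Omega> lborel W (\<lambda>x. ennreal (gig_density p a b x))"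
    and "set_borel_measurable borel {0<..} h"
    and "bounded (h ` {0<..})"
  defines "r \<equiv> \<lambda>x. h x - expectation_pos \<Omega> W h"
  defines "f\<^sub>h \<equiv> gig_stein_f p a b r"
  shows "gig_stein_solution_ae p a b r f\<^sub>h
    \<and> (\<forall>x>0. f\<^sub>h x = - 1 / (stein_s x * gig_density p a b x)
                      * (LBINT t:{x<..}. gig_density p a b t * r t))
    \<and> (continuous_on {0<..} h \<and> p \<le> - 1 \<longrightarrow>
         gig_stein_solution p a b r f\<^sub>h
         \<and> bounded (f\<^sub>h ` {0<..})
         \<and> (\<forall>f. gig_stein_solution p a b r f \<and> bounded (f ` {0<..})
                 \<longrightarrow> (\<forall>x>0. f x = f\<^sub>h x))
         \<and> sup_norm_pos f\<^sub>h \<le> gig_M p a b * sup_norm_pos r)"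
proof -
  interpret gig p a b
    using assms(1-4) by (rule gig_if_distributed)
  define m where "m = expectation_pos \<Omega> W h"
  have m: "m = (LBINT t. g t * h t)"
    unfolding m_def using assms(4,5) by (rule expectation_pos_eq)
  have inth: "integrable lborel (\<lambda>t. g t * h t)"
    using assms(5,6) by (rule integrable_density_mult)
  have gr: "g t * r t = g t * h t - m * g t" for t
    by (simp add: r_def m_def algebra_simps)
  have int: "integrable lborel (\<lambda>t. g t * r t)"
    unfolding gr using inth density_integrable by simp
  have centred: "(LBINT t. g t * r t) = 0"
    unfolding gr using inth density_integrable density_mass by (simp add: m)
  have "bounded (r ` {0<..})"
    unfolding r_def by (rule bounded_minus_comp[OF assms(6)]) (auto simp: bounded_iff)
  note R = abs_le_sup_norm_pos[OF this]
  have ae: "gig_stein_solution_ae p a b r f\<^sub>h"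
    unfolding f\<^sub>h_def by (rule stein_f_solution_ae[OF int R])
  have tail: "f\<^sub>h x = - 1 / (stein_s x * g x) * (LBINT t:{x<..}. g t * r t)" if "x > 0" for x
    using stein_f_eq_tail[OF int centred, of x] that by (simp add: f\<^sub>h_def gig_weight_def)
  have bounded_case: "gig_stein_solution p a b r f\<^sub>h \<and> bounded (f\<^sub>h ` {0<..})
      \<and> (\<forall>f. gig_stein_solution p a b r f \<and> bounded (f ` {0<..}) \<longrightarrow> (\<forall>x>0. f x = f\<^sub>h x))
      \<and> sup_norm_pos f\<^sub>h \<le> gig_M p a b * sup_norm_pos r"
    if cont: "continuous_on {0<..} h" and p: "p \<le> - 1"
  proof -
    have "isCont r x" if "x > 0" for x
      using cont that unfolding r_def
      by (intro continuous_intros) (simp add: continuous_on_eq_continuous_at)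
    then have sol: "gig_stein_solution p a b r f\<^sub>h"
      using ae unfolding gig_stein_solution_ae_def gig_stein_solution_def by blast
    have bd: "\<bar>f\<^sub>h x\<bar> \<le> gig_M p a b * sup_norm_pos r" if "x > 0" for x
      using stein_f_bound[OF p int centred R that gig_alpha_pos[OF a_pos b_pos, of p]]
      by (simp add: f\<^sub>h_def gig_M_def Let_def gig_weight_def mult.commute)
    then have bdd: "bounded (f\<^sub>h ` {0<..})"
      by (auto simp: bounded_iff)
    show ?thesis
    proof (intro conjI allI impI sol bdd sup_norm_pos_le bd)
      fix f x assume "gig_stein_solution p a b r f \<and> bounded (f ` {0<..})" and "x > (0::real)"
      then show "f x = f\<^sub>h x"
        using bounded_stein_solution_unique[OF p _ _ sol bdd] by simp
    qed
  qed
  show ?thesis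
    by (intro conjI allI impI ae tail) (use bounded_case in simp_all)
qed

end
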